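(* Fix an integer $a\geq 1$. Suppose that \[ \lim_{p\to\infty}\min_{I\in\mathcal{I}_a(G_p)} \frac{2^{a+1}}{\sqrt p}\lambda_{\min}(A_{G_{p,I}}) = \lim_{p\to\infty}\max_{I\in\mathcal{I}_a(G_p)} \frac{2^{a+1}}{\sqrt p}\lambda_{\min}(A_{G_{p,I}}) = -2\sqrt{2^a-1}. \] Then, as $p\to\infty$, \[ \omega(G_p) = \alpha(G_p) \leq \frac{\sqrt{2^a-1}}{2^{a-1}}\sqrt{p} + o(\sqrt p). \]
   Context: Throughout, $p$ denotes a prime with $p \equiv 1 \pmod 4$, and limits and asymptotic notation refer to $p\to\infty$ over such primes. The Paley graph $G_p$ has vertex set $\mathbb{F}_p=\mathbb{Z}/p\mathbb{Z}$, with $x \sim y$ iff $x - y$ is a nonzero quadratic residue mod $p$. For a graph $G$, $\omega(G)$ is its clique number, $\alpha(G)$ its independence number, $\mathcal{I}_a(G)$ the set of independent sets of size $a$, $A_G$ its $\{0,1\}$-valued adjacency matrix, and $\lambda_{\min}$ the smallest eigenvalue. For $X\subseteq\mathbb{F}_p$, $G_{p,X}$ is the subgraph of $G_p$ induced on the set of vertices not in $X$ and not adjacent to any vertex of $X$. *)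

theory Defs
  imports
    "HOL-Number_Theory.Residues"
    "HOL-Library.Landau_Symbols"
    "Graph_Theory.Digraph_Component"
    "Graph_Theory.Pair_Digraph"
    "Jordan_Normal_Form.Spectral_Radius"
begin

text \<open>A simple graph is encoded as a symmetric loop-free digraph, with both arcs present for
  every edge.\<close>

definition is_clique :: "('a, 'b) pre_digraph \<Rightarrow> 'a set \<Rightarrow> bool" where
  "is_clique G S \<longleftrightarrow>
     S \<subseteq> verts G \<and> (\<forall>u\<in>S. \<forall>v\<in>S. u \<noteq> v \<longrightarrow> u \<rightarrow>\<^bsub>G\<^esub> v)"

definition is_independent :: "('a, 'b) pre_digraph \<Rightarrow> 'a set \<Rightarrow> bool" where
  "is_independent G S \<longleftrightarrow>
     S \<subseteq> verts G \<and> (\<forall>u\<in>S. \<forall>v\<in>S. \<not> (u \<rightarrow>\<^bsub>G\<^esub> v))"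

definition clique_number :: "('a, 'b) pre_digraph \<Rightarrow> nat" where
  "clique_number G = Max (card ` {S. is_clique G S})"

definition independence_number :: "('a, 'b) pre_digraph \<Rightarrow> nat" where
  "independence_number G = Max (card ` {S. is_independent G S})"

definition independent_sets :: "nat \<Rightarrow> ('a, 'b) pre_digraph \<Rightarrow> 'a set set" where
  "independent_sets a G = {S. is_independent G S \<and> card S = a}"

text \<open>Rows and columns are indexed by the vertices in increasing order; the spectrum does not
  depend on this choice.\<close>

definition adjacency_matrix :: "('a :: linorder, 'b) pre_digraph \<Rightarrow> real mat" where
  "adjacency_matrix G =
     (let vs = sorted_list_of_set (verts G)
      in mat (length vs) (length vs) (\<lambda>(i, j). if (vs ! i) \<rightarrow>\<^bsub>G\<^esub> (vs ! j) then 1 else 0))"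

text \<open>Meaningful for symmetric matrices of positive dimension, whose spectrum over the reals is
  finite, nonempty, and contains all complex eigenvalues.\<close>

definition lambda_min :: "real mat \<Rightarrow> real" where
  "lambda_min A = Min (spectrum A)"

text \<open>The field with \<open>p\<close> elements is represented by the residues \<open>0, \<dots>, p - 1\<close>.\<close>

definition paley_graph :: "nat \<Rightarrow> (int, int \<times> int) pre_digraph" where
  "paley_graph p = with_proj
     \<lparr> pverts = {0..<int p},
       parcs = {(x, y). x \<in> {0..<int p} \<and> y \<in> {0..<int p} \<and>
                        \<not> [x - y = 0] (mod int p) \<and> QuadRes (int p) (x - y)} \<rparr>"

definition paley_localization :: "nat \<Rightarrow> int set \<Rightarrow> (int, int \<times> int) pre_digraph" where
  "paley_localization p X =
     paley_graph p \<restriction>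
       {v \<in> verts (paley_graph p). v \<notin> X \<and> (\<forall>x\<in>X. \<not> (v \<rightarrow>\<^bsub>paley_graph p\<^esub> x))}"

definition paley_primes :: "nat set" where
  "paley_primes = {p. prime p \<and> [p = 1] (mod 4)}"

text \<open>The filter of \<open>p\<close> tending to infinity along the primes congruent to 1 modulo 4.\<close>

definition paley_at_top :: "nat filter" where
  "paley_at_top = inf at_top (principal paley_primes)"

end

theory Submission
  imports Defs "HOL-Analysis.Convex" "HOL-Number_Theory.Euler_Criterion"
begin

text \<open>Let \<open>S\<close> be a maximum independent set of the Paley graph and \<open>I \<subseteq> S\<close> of size \<open>a\<close>. The set
  \<open>S - I\<close> is independent in the localization at \<open>I\<close>, with \<open>n\<close> vertices, say, and Hoffman's argument
  bounds its size \<open>t\<close> by \<open>- 2 \<lambda>\<^sub>m\<^sub>i\<^sub>n (1 + o(1))\<close>, provided that edges are distributed uniformly: there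
  are about \<open>n\<^sup>2 / 2\<close> ordered adjacent pairs of vertices and about \<open>t n / 2\<close> of them start in \<open>S - I\<close>.
  Both follow from the elementary estimate \<open>\<bar>\<Sum> \<chi>(u - w)\<bar> \<le> \<surd>(p \<bar>U\<bar> \<bar>W\<bar>)\<close> over \<open>u \<in> U\<close>, \<open>w \<in> W\<close>
  once \<open>n\<close> is of order \<open>p\<close>. The Weil bound would give \<open>n \<sim> p / 2^a\<close> for every \<open>I\<close>; since the value of
  \<open>n\<close> cancels in Hoffman's bound and \<open>I\<close> may be chosen freely inside \<open>S\<close>, a greedy choice with
  \<open>n \<ge> p / 8^a\<close> suffices.\<close>

section \<open>Positive semidefinite forms and the smallest eigenvalue\<close>

text \<open>At its minimiser \<open>s = - b / c\<close> the polynomial takes the value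
  \<open>a - b\<^sup>2 / c\<close>. If \<open>c = 0\<close>, it is affine in \<open>s\<close> and
  can stay nonnegative only when its slope vanishes.\<close>

lemma quadratic_nonneg_imp_discriminant_le:
  fixes a b c :: real
  assumes "c \<ge> 0"
    and nonneg: "\<And>s. 0 \<le> a + 2 * s * b + s\<^sup>2 * c"
  shows "b\<^sup>2 \<le> a * c"
proof (cases "c = 0")
  case True
  have "b = 0"
  proof (rule ccontr)
    assume "b \<noteq> 0"
    \<comment> \<open>This \<open>s\<close> makes the affine expression equal to -1.\<close>
    with nonneg[of "- (a + 1) / (2 * b)"] True show False by (simp add: field_simps)
  qed
  with True show ?thesis by simp
next
  case False
  with assms(1) have c: "c > 0" by simp
  have "0 \<le> a - b\<^sup>2 / c"
    using nonneg[of "- b / c"] c by (simp add: field_simps power2_eq_square)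
  with c show ?thesis by (simp add: field_simps)
qed

text \<open>Evaluating the form at \<open>f + s * g\<close> gives a quadratic polynomial in
  \<open>s\<close> that is nowhere negative, so its discriminant is not positive. This serves both
  the eigenvalue argument and Hoffman's bound.\<close>

lemma psd_form_Cauchy_Schwarz:
  fixes M :: "'i \<Rightarrow> 'i \<Rightarrow> real"
  assumes sym: "\<And>u v. u \<in> V \<Longrightarrow> v \<in> V \<Longrightarrow> M u v = M v u"
    and psd: "\<And>f. 0 \<le> (\<Sum>u\<in>V. \<Sum>v\<in>V. M u v * f u * f v)"
  shows "(\<Sum>u\<in>V. \<Sum>v\<in>V. M u v * f u * g v)\<^sup>2
    \<le> (\<Sum>u\<in>V. \<Sum>v\<in>V. M u v * f u * f v) * (\<Sum>u\<in>V. \<Sum>v\<in>V. M u v * g u * g v)"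
proof -
  define Q where "Q f g = (\<Sum>u\<in>V. \<Sum>v\<in>V. M u v * f u * g v)" for f g :: "'i \<Rightarrow> real"
  have Qsym: "Q g f = Q f g"
  proof -
    have "Q g f = (\<Sum>v\<in>V. \<Sum>u\<in>V. M u v * g u * f v)" unfolding Q_def by (rule sum.swap)
    also have "\<dots> = Q f g" unfolding Q_def using sym by (intro sum.cong) auto
    finally show ?thesis .
  qed
  have "0 \<le> Q f f + 2 * s * Q f g + s\<^sup>2 * Q g g" for s
  proof -
    have "0 \<le> Q (\<lambda>u. f u + s * g u) (\<lambda>u. f u + s * g u)" unfolding Q_def by (rule psd)
    also have "\<dots> = Q f f + s * Q f g + s * Q g f + s\<^sup>2 * Q g g"
      unfolding Q_def by (simp add: algebra_simps sum.distrib sum_distrib_left power2_eq_square)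
    finally show ?thesis using Qsym by (simp add: algebra_simps)
  qed
  moreover have "Q g g \<ge> 0" unfolding Q_def by (rule psd)
  ultimately show ?thesis unfolding Q_def[symmetric]
    by (intro quadratic_nonneg_imp_discriminant_le)
qed

text \<open>Every product of two values is at most the sum of all squares. The bound is crude, but
  only boundedness of a form on the unit sphere matters below.\<close>

lemma abs_quadratic_form_le:
  fixes M :: "'i \<Rightarrow> 'i \<Rightarrow> real"
  assumes "finite V"
  shows "\<bar>\<Sum>u\<in>V. \<Sum>v\<in>V. M u v * f u * f v\<bar> \<le> (\<Sum>u\<in>V. \<Sum>v\<in>V. \<bar>M u v\<bar>) * (\<Sum>u\<in>V. (f u)\<^sup>2)"
proof -
  have entry: "\<bar>f u * f v\<bar> \<le> (\<Sum>u\<in>V. (f u)\<^sup>2)" if "u \<in> V" "v \<in> V" for u v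
  proof -
    have "(f u)\<^sup>2 \<le> (\<Sum>u\<in>V. (f u)\<^sup>2)" "(f v)\<^sup>2 \<le> (\<Sum>u\<in>V. (f u)\<^sup>2)"
      using that assms by (auto intro: member_le_sum)
    moreover have "2 * \<bar>f u * f v\<bar> \<le> (f u)\<^sup>2 + (f v)\<^sup>2"
      using sum_squares_bound[of "\<bar>f u\<bar>" "\<bar>f v\<bar>"] by (simp add: abs_mult)
    ultimately show ?thesis by linarith
  qed
  have "\<bar>\<Sum>u\<in>V. \<Sum>v\<in>V. M u v * f u * f v\<bar> \<le> (\<Sum>u\<in>V. \<Sum>v\<in>V. \<bar>M u v * f u * f v\<bar>)"
    by (rule order_trans[OF sum_abs]) (intro sum_mono sum_abs)
  also have "\<dots> \<le> (\<Sum>u\<in>V. \<Sum>v\<in>V. \<bar>M u v\<bar> * (\<Sum>u\<in>V. (f u)\<^sup>2))"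
  proof (intro sum_mono)
    fix u v assume "u \<in> V" "v \<in> V"
    then show "\<bar>M u v * f u * f v\<bar> \<le> \<bar>M u v\<bar> * (\<Sum>u\<in>V. (f u)\<^sup>2)"
      using mult_left_mono[OF entry, of u v "\<bar>M u v\<bar>"] by (simp add: abs_mult mult.assoc)
  qed
  finally show ?thesis by (simp add: sum_distrib_right)
qed

text \<open>The infimum \<open>m\<close> of the Rayleigh quotient is an eigenvalue: otherwise \<open>A - m\<close> has an inverse
  \<open>C\<close>, and Cauchy--Schwarz for the form of \<open>A - m\<close>, applied to \<open>x\<close> and \<open>C x\<close>, bounds the
  Rayleigh quotient of \<open>A - m\<close> away from zero.\<close>

lemma lambda_min_le_Rayleigh_form:
  fixes A :: "real mat"
  assumes A: "A \<in> carrier_mat n n"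
    and sym: "\<And>i j. i < n \<Longrightarrow> j < n \<Longrightarrow> A $$ (i, j) = A $$ (j, i)"
  shows "lambda_min A * (\<Sum>i<n. (x i)\<^sup>2) \<le> (\<Sum>i<n. \<Sum>j<n. A $$ (i, j) * x i * x j)"
proof (cases "n = 0")
  case True
  then show ?thesis by simp
next
  case False
  define q where "q x = (\<Sum>i<n. \<Sum>j<n. A $$ (i, j) * x i * x j)" for x :: "nat \<Rightarrow> real"
  define N where "N x = (\<Sum>i<n. (x i)\<^sup>2)" for x :: "nat \<Rightarrow> real"
  define R where "R = {q x | x. N x = 1}"
  define m where "m = Inf R"
  \<comment> \<open>The first unit vector, available because the dimension is positive, shows that
    the unit sphere is nonempty.\<close>
  have "N (\<lambda>i. if i = 0 then 1 else 0) = (\<Sum>i<n. if i = 0 then 1 else 0)"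
    unfolding N_def by (intro sum.cong) auto
  then have "N (\<lambda>i. if i = 0 then 1 else 0) = 1" using False by simp
  then have R_ne: "R \<noteq> {}" unfolding R_def by blast
  have R_bdd: "bdd_below R"
  proof (rule bdd_belowI)
    fix r assume "r \<in> R"
    then obtain x where "r = q x" "N x = 1" unfolding R_def by blast
    then show "- (\<Sum>i<n. \<Sum>j<n. \<bar>A $$ (i, j)\<bar>) \<le> r"
      using abs_quadratic_form_le[of "{..<n}" "\<lambda>i j. A $$ (i, j)" x]
      by (simp add: q_def N_def)
  qed
  have q_ge: "m * N x \<le> q x" for x
  proof (cases "N x = 0")
    case True
    then have "q x = 0"
      using abs_quadratic_form_le[of "{..<n}" "\<lambda>i j. A $$ (i, j)" x] by (simp add: q_def N_def)
    with True show ?thesis by simp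
  next
    case nz: False
    define c where "c = sqrt (N x)"
    have "N x \<ge> 0" unfolding N_def by (intro sum_nonneg) simp
    with nz have c: "c > 0" "c\<^sup>2 = N x" unfolding c_def by auto
    have "N (\<lambda>i. x i / c) = N x / c\<^sup>2"
      unfolding N_def by (simp add: power_divide sum_divide_distrib)
    then have "N (\<lambda>i. x i / c) = 1" using c nz by simp
    then have "m \<le> q (\<lambda>i. x i / c)" unfolding m_def
      by (intro cInf_lower R_bdd) (auto simp: R_def)
    also have "\<dots> = q x / c\<^sup>2"
      unfolding q_def by (simp add: power2_eq_square sum_divide_distrib)
    finally show ?thesis using c(1) by (simp add: pos_le_divide_eq flip: c(2))
  qed
  \<comment> \<open>Entries of A - m, that is, of \<open>char_matrix A m\<close>; its form is
    positive semidefinite by \<open>q_ge\<close>.\<close>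
  define B where "B i j = A $$ (i, j) - (if i = j then m else 0)" for i j
  have Bform: "(\<Sum>i<n. \<Sum>j<n. B i j * x i * x j) = q x - m * N x" for x
  proof -
    have "(\<Sum>i<n. \<Sum>j<n. B i j * x i * x j)
        = q x - (\<Sum>i<n. \<Sum>j<n. if i = j then m * x i * x j else 0)"
      unfolding q_def B_def sum_subtractf[symmetric] by (intro sum.cong) (auto simp: algebra_simps)
    also have "(\<Sum>i<n. \<Sum>j<n. if i = j then m * x i * x j else 0) = m * N x"
      unfolding N_def by (simp add: sum_distrib_left power2_eq_square mult.assoc)
    finally show ?thesis .
  qed
  have "eigenvalue A m"
  proof (rule ccontr)
    assume "\<not> eigenvalue A m"
    then have "det (char_matrix A m) \<noteq> 0" using eigenvalue_det[OF A] by simp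
    from det_non_zero_imp_unit[OF _ this, of n "()"] A
    obtain C where C: "C \<in> carrier_mat n n" and BC: "char_matrix A m * C = 1\<^sub>m n"
      unfolding Units_def by (auto simp: ring_mat_def)
    have inv: "(\<Sum>k<n. B i k * C $$ (k, j)) = (if i = j then 1 else 0)" if "i < n" "j < n" for i j
    proof -
      have "(\<Sum>k<n. B i k * C $$ (k, j)) = (char_matrix A m * C) $$ (i, j)"
        using that A C
        by (auto simp: char_matrix_def scalar_prod_def B_def atLeast0LessThan intro!: sum.cong)
      then show ?thesis using that BC by simp
    qed
    \<comment> \<open>\<open>K\<close> bounds the form of the inverse on unit vectors; the summand 1
      keeps it positive.\<close>
    define K where "K = 1 + (\<Sum>i<n. \<Sum>j<n. \<bar>C $$ (i, j)\<bar>)"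
    have K: "K > 0" unfolding K_def by (smt (verit) sum_nonneg abs_ge_zero)
    \<comment> \<open>With y = C x one has B y = x, so the mixed form at x and y is the squared norm
      1 and the form at y is the inner product of y and x, at most \<open>K\<close>. Cauchy-Schwarz
      then gives 1 \<le> (q x - m) K.\<close>
    have gap: "m + 1 / K \<le> q x" if "N x = 1" for x
    proof -
      define y where "y i = (\<Sum>j<n. C $$ (i, j) * x j)" for i
      have By: "(\<Sum>k<n. B i k * y k) = x i" if "i < n" for i
      proof -
        have "(\<Sum>k<n. B i k * y k) = (\<Sum>k<n. \<Sum>j<n. B i k * C $$ (k, j) * x j)"
          unfolding y_def by (simp add: sum_distrib_left mult.assoc)
        also have "\<dots> = (\<Sum>j<n. \<Sum>k<n. B i k * C $$ (k, j) * x j)" by (rule sum.swap)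
        also have "\<dots> = (\<Sum>j<n. (if i = j then 1 else 0) * x j)"
          using inv[OF that] by (simp add: sum_distrib_right[symmetric])
        also have "\<dots> = (\<Sum>j<n. if i = j then x j else 0)" by (intro sum.cong) auto
        finally show ?thesis using that by simp
      qed
      have form_y: "(\<Sum>i<n. \<Sum>j<n. B i j * z i * y j) = (\<Sum>i<n. z i * x i)" for z
      proof -
        have "(\<Sum>i<n. \<Sum>j<n. B i j * z i * y j) = (\<Sum>i<n. z i * (\<Sum>j<n. B i j * y j))"
          by (simp add: sum_distrib_left mult_ac)
        then show ?thesis using By by simp
      qed
      have "(\<Sum>i<n. \<Sum>j<n. B i j * x i * y j)\<^sup>2
          \<le> (\<Sum>i<n. \<Sum>j<n. B i j * x i * x j) * (\<Sum>i<n. \<Sum>j<n. B i j * y i * y j)"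
      proof (rule psd_form_Cauchy_Schwarz)
        show "B i j = B j i" if "i \<in> {..<n}" "j \<in> {..<n}" for i j
          using that sym by (simp add: B_def)
        show "0 \<le> (\<Sum>i<n. \<Sum>j<n. B i j * f i * f j)" for f
          using q_ge[of f] by (simp add: Bform)
      qed
      then have "1 \<le> (q x - m) * (\<Sum>i<n. y i * x i)"
        unfolding form_y Bform using that by (simp add: N_def power2_eq_square)
      also have "(\<Sum>i<n. y i * x i) = (\<Sum>i<n. \<Sum>j<n. C $$ (i, j) * x i * x j)"
        unfolding y_def by (simp add: sum_distrib_left mult_ac)
      also have "(q x - m) * \<dots> \<le> (q x - m) * K"
        using q_ge[of x] that abs_quadratic_form_le[of "{..<n}" "\<lambda>i j. C $$ (i, j)" x]
        by (intro mult_left_mono) (auto simp: K_def N_def)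
      finally show ?thesis using K by (simp add: field_simps)
    qed
    have "m + 1 / K \<le> Inf R" by (rule cInf_greatest[OF R_ne]) (use gap in \<open>auto simp: R_def\<close>)
    then show False using K by (simp add: m_def)
  qed
  then have "lambda_min A \<le> m" unfolding lambda_min_def
    by (intro Min_le card_finite_spectrum(1)[OF A]) (simp add: spectrum_def)
  moreover have "N x \<ge> 0" unfolding N_def by (intro sum_nonneg) simp
  ultimately have "lambda_min A * N x \<le> m * N x" by (rule mult_right_mono)
  with q_ge[of x] show ?thesis unfolding q_def N_def by linarith
qed

text \<open>Reindexing along the sorted vertex list moves the Rayleigh bound from matrix indices to
  functions on the vertices, the setting of Hoffman's argument.\<close>

lemma adjacency_matrix_lambda_min_le_form:
  fixes G :: "('a :: linorder, 'b) pre_digraph"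
  assumes fin: "finite (verts G)"
    and sym: "\<And>u v. u \<rightarrow>\<^bsub>G\<^esub> v \<Longrightarrow> v \<rightarrow>\<^bsub>G\<^esub> u"
  shows "lambda_min (adjacency_matrix G) * (\<Sum>u\<in>verts G. (f u)\<^sup>2)
    \<le> (\<Sum>u\<in>verts G. \<Sum>v\<in>verts G. (if u \<rightarrow>\<^bsub>G\<^esub> v then 1 else 0) * f u * f v)"
proof -
  define vs where "vs = sorted_list_of_set (verts G)"
  define n where "n = length vs"
  have bij: "bij_betw ((!) vs) {..<n} (verts G)"
    using fin by (intro bij_betw_nth) (auto simp: vs_def n_def)
  have A: "adjacency_matrix G = mat n n (\<lambda>(i, j). if (vs ! i) \<rightarrow>\<^bsub>G\<^esub> (vs ! j) then 1 else 0)"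
    by (simp add: adjacency_matrix_def vs_def n_def Let_def)
  have "lambda_min (adjacency_matrix G) * (\<Sum>i<n. (f (vs ! i))\<^sup>2)
      \<le> (\<Sum>i<n. \<Sum>j<n. adjacency_matrix G $$ (i, j) * f (vs ! i) * f (vs ! j))"
    by (rule lambda_min_le_Rayleigh_form) (use sym in \<open>auto simp: A\<close>)
  also have "\<dots> = (\<Sum>i<n. \<Sum>j<n. (if (vs ! i) \<rightarrow>\<^bsub>G\<^esub> (vs ! j) then 1 else 0) * f (vs ! i) * f (vs ! j))"
    by (intro sum.cong) (auto simp: A)
  finally show ?thesis
    by (simp only: sum.reindex_bij_betw[OF bij, of "\<lambda>u. (f u)\<^sup>2"]
      sum.reindex_bij_betw[OF bij, of "\<lambda>v. (if u \<rightarrow>\<^bsub>G\<^esub> v then 1 else 0) * f u * f v" for u]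
      sum.reindex_bij_betw[OF bij, of "\<lambda>u. \<Sum>v\<in>verts G. (if u \<rightarrow>\<^bsub>G\<^esub> v then 1 else 0) * f u * f v"])
qed

section \<open>Sums of Legendre symbols\<close>

lemma Legendre_cong:
  assumes "[x = y] (mod p)"
  shows "Legendre x p = Legendre y p"
proof -
  have "[x = 0] (mod p) \<longleftrightarrow> [y = 0] (mod p)" "QuadRes p x \<longleftrightarrow> QuadRes p y"
    using assms unfolding QuadRes_def by (blast intro: cong_trans cong_sym)+
  then show ?thesis by (simp add: Legendre_def)
qed

lemma Legendre_mod [simp]: "Legendre (x mod p) p = Legendre x p"
  by (rule Legendre_cong) (simp add: cong_def)

lemma Legendre_add_mod [simp]: "Legendre (d + x mod p) p = Legendre (d + x) p"
  by (rule Legendre_cong) (simp add: cong_def mod_add_right_eq)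

lemma Legendre_values: "Legendre x p = 0 \<or> Legendre x p = 1 \<or> Legendre x p = - 1"
  by (simp add: Legendre_def)

lemma Legendre_eq_0_iff: "Legendre x p = 0 \<longleftrightarrow> p dvd x"
  by (simp add: Legendre_def cong_0_iff)

lemma Legendre_square: "Legendre x p * Legendre x p = (if p dvd x then 0 else 1)"
  by (simp add: Legendre_def cong_0_iff)

context
  fixes p :: nat
  assumes prime: "prime p" and gt_2: "2 < p"
begin

text \<open>Euler's criterion gives the identity modulo \<open>p\<close>. The two sides differ by at
  most 2, which is less than \<open>p\<close>, so the congruence is an equality.\<close>

lemma Legendre_mult: "Legendre (x * y) (int p) = Legendre x (int p) * Legendre y (int p)"
proof -
  have "[Legendre (x * y) (int p) = (x * y) ^ ((p - 1) div 2)] (mod int p)"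
    "[Legendre x (int p) * Legendre y (int p) = x ^ ((p - 1) div 2) * y ^ ((p - 1) div 2)] (mod int p)"
    using euler_criterion[OF prime gt_2] by (auto intro: cong_mult)
  then have "[Legendre (x * y) (int p) = Legendre x (int p) * Legendre y (int p)] (mod int p)"
    by (metis cong_sym cong_trans power_mult_distrib)
  then have "int p dvd Legendre (x * y) (int p) - Legendre x (int p) * Legendre y (int p)"
    by (simp add: cong_iff_dvd_diff)
  moreover have "\<bar>Legendre (x * y) (int p) - Legendre x (int p) * Legendre y (int p)\<bar> \<le> 2"
    using Legendre_values[of "x * y" "int p"] Legendre_values[of x "int p"]
      Legendre_values[of y "int p"] by auto
  ultimately show ?thesis
    using gt_2 dvd_imp_le_int[of "Legendre (x * y) (int p) - Legendre x (int p) * Legendre y (int p)" "int p"]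
    by auto
qed

text \<open>Squaring identifies \<open>1\<close> and \<open>p - 1\<close>, so it is not onto the residues.\<close>

lemma quadratic_nonresidue_exists: "\<exists>g. Legendre g (int p) = - 1"
proof -
  let ?F = "{0..<int p}" and ?sq = "\<lambda>x. x\<^sup>2 mod int p"
  have "?sq (int p - 1) = (1 + int p * (int p - 2)) mod int p"
    by (simp add: power2_eq_square algebra_simps)
  then have "?sq (int p - 1) = 1 mod int p" by (simp only: mod_mult_self2)
  then have "?sq (int p - 1) = ?sq 1" by simp
  moreover have "1 \<in> ?F" "int p - 1 \<in> ?F" "int p - 1 \<noteq> 1" using gt_2 by auto
  ultimately have "\<not> inj_on ?sq ?F" unfolding inj_on_def by blast
  moreover have sub: "?sq ` ?F \<subseteq> ?F" using gt_2 by auto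
  ultimately have "?sq ` ?F \<noteq> ?F" using finite_surj_inj[of ?F ?sq] by auto
  with sub obtain g where g: "g \<in> ?F" "g \<notin> ?sq ` ?F" by blast
  have "\<not> QuadRes (int p) g"
  proof
    assume "QuadRes (int p) g"
    then obtain y where "y\<^sup>2 mod int p = g mod int p" by (auto simp: QuadRes_def cong_def)
    then have "?sq (y mod int p) = g" using g(1) by (simp add: power_mod)
    moreover have "y mod int p \<in> ?F" using gt_2 by simp
    ultimately show False using g(2) by blast
  qed
  moreover have "\<not> [g = 0] (mod int p)"
  proof
    assume "[g = 0] (mod int p)"
    then have "g = 0" using g(1) by (simp add: cong_def)
    with g(2) gt_2 show False by force
  qed
  ultimately show ?thesis by (intro exI[of _ g]) (simp add: Legendre_def)
qed

section \<open>Complete character sums and the bilinear estimate\<close>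

lemma bij_betw_affine_mod:
  assumes "\<not> int p dvd c"
  shows "bij_betw (\<lambda>x. (c * x + d) mod int p) {0..<int p} {0..<int p}"
proof -
  have "inj_on (\<lambda>x. (c * x + d) mod int p) {0..<int p}"
  proof (rule inj_onI)
    fix x y
    assume xy: "x \<in> {0..<int p}" "y \<in> {0..<int p}" "(c * x + d) mod int p = (c * y + d) mod int p"
    then have "int p dvd c * (x - y)" by (simp add: mod_eq_dvd_iff algebra_simps)
    then have "int p dvd x - y" using assms prime by (simp add: prime_dvd_mult_iff)
    then have "x mod int p = y mod int p" by (simp add: mod_eq_dvd_iff)
    with xy show "x = y" by simp
  qed
  moreover have "(\<lambda>x. (c * x + d) mod int p) ` {0..<int p} \<subseteq> {0..<int p}" using gt_2 by auto
  ultimately show ?thesis unfolding bij_betw_def by (simp add: endo_inj_surj)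
qed

lemma sum_residues_affine:
  assumes "\<not> int p dvd c" and "\<And>x. h (x mod int p) = h x"
  shows "(\<Sum>x\<in>{0..<int p}. h (c * x + d)) = (\<Sum>x\<in>{0..<int p}. h x)"
  using sum.reindex_bij_betw[OF bij_betw_affine_mod[OF assms(1)], of h d] assms(2) by simp

text \<open>Multiplication by a nonresidue permutes the residues and changes the sign of every
  symbol, so the sum equals its own negative.\<close>

lemma sum_Legendre_eq_0: "(\<Sum>x\<in>{0..<int p}. Legendre (d + x) (int p)) = 0"
proof -
  obtain g where g: "Legendre g (int p) = - 1" using quadratic_nonresidue_exists by blast
  then have "\<not> int p dvd g" using Legendre_eq_0_iff[of g "int p"] by auto
  from sum_residues_affine[OF this, of "\<lambda>x. Legendre x (int p)" 0]
  have "(\<Sum>x\<in>{0..<int p}. Legendre x (int p)) = 0" by (simp add: Legendre_mult g sum_negf)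
  moreover have "\<not> int p dvd 1" using gt_2 by simp
  ultimately show ?thesis
    using sum_residues_affine[of 1 "\<lambda>x. Legendre x (int p)" d] by (simp add: add.commute)
qed

text \<open>The correlation at a nonzero shift \<open>d\<close> does not depend on \<open>d\<close>, by rescaling, and the
  correlations over all shifts add up to the square of the full character sum, which vanishes.\<close>

lemma Legendre_correlation:
  assumes "\<not> int p dvd d"
  shows "(\<Sum>x\<in>{0..<int p}. Legendre x (int p) * Legendre (d + x) (int p)) = - 1"
proof -
  define R where "R d = (\<Sum>x\<in>{0..<int p}. Legendre x (int p) * Legendre (d + x) (int p))" for d
  have scale: "R d = R 1" if "\<not> int p dvd d" for d
  proof -
    have "R d = (\<Sum>x\<in>{0..<int p}. Legendre (d * x) (int p) * Legendre (d + d * x) (int p))"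
      unfolding R_def
      using sum_residues_affine[OF that,
          of "\<lambda>x. Legendre x (int p) * Legendre (d + x) (int p)" 0]
      by simp
    also have "\<dots> = (\<Sum>x\<in>{0..<int p}. (Legendre d (int p) * Legendre d (int p))
        * (Legendre x (int p) * Legendre (1 + x) (int p)))"
    proof (rule sum.cong)
      fix x
      have "d + d * x = d * (1 + x)" by (simp add: distrib_left)
      then show "Legendre (d * x) (int p) * Legendre (d + d * x) (int p)
          = (Legendre d (int p) * Legendre d (int p))
            * (Legendre x (int p) * Legendre (1 + x) (int p))"
        by (simp only: Legendre_mult mult_ac)
    qed simp
    also have "\<dots> = R 1" using that by (simp add: Legendre_square R_def)
    finally show ?thesis .
  qed
  have F: "{0..<int p} = insert 0 {1..<int p}" using gt_2 by auto
  have not_dvd: "\<not> int p dvd d" if "d \<in> {1..<int p}" for d using that by (auto dest: zdvd_imp_le)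
  have "(\<Sum>d\<in>{0..<int p}. R d)
      = (\<Sum>x\<in>{0..<int p}. Legendre x (int p) * (\<Sum>d\<in>{0..<int p}. Legendre (x + d) (int p)))"
    unfolding R_def sum_distrib_left by (subst sum.swap) (simp add: add.commute)
  then have "(\<Sum>d\<in>{0..<int p}. R d) = 0" by (simp add: sum_Legendre_eq_0)
  moreover have "(\<Sum>d\<in>{0..<int p}. R d) = R 0 + (\<Sum>d\<in>{1..<int p}. R 1)"
  proof -
    have "(\<Sum>d\<in>{1..<int p}. R d) = (\<Sum>d\<in>{1..<int p}. R 1)"
      by (rule sum.cong[OF refl]) (rule scale[OF not_dvd])
    then show ?thesis unfolding F by simp
  qed
  moreover have "R 0 = int p - 1"
    unfolding R_def F using not_dvd gt_2 by (simp add: Legendre_square Legendre_eq_0_iff)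
  ultimately have "(int p - 1) * (R 1 + 1) = 0" using gt_2 by (simp add: algebra_simps)
  then have "R 1 = - 1" using gt_2 by simp
  with scale[OF assms] show ?thesis by (simp add: R_def)
qed

text \<open>Approximate orthogonality of the translates of the character: the off-diagonal value -1
  is rounded up to 0, and on the diagonal each term is at most 1.\<close>

lemma sum_Legendre_differences:
  "(\<Sum>v\<in>{0..<int p}. Legendre (v - x) (int p) * Legendre (v - y) (int p))
    \<le> (if int p dvd x - y then int p else 0)"
proof -
  have "(\<Sum>v\<in>{0..<int p}. Legendre (v - x) (int p) * Legendre (v - y) (int p))
      = (\<Sum>v\<in>{0..<int p}. Legendre v (int p) * Legendre (x - y + v) (int p))"
    using sum_residues_affine[of 1 "\<lambda>v. Legendre v (int p) * Legendre (x - y + v) (int p)" "- x"] gt_2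
    by simp
  also have "\<dots> \<le> (if int p dvd x - y then int p else 0)"
  proof (cases "int p dvd x - y")
    case True
    have "(\<Sum>v\<in>{0..<int p}. Legendre v (int p) * Legendre (x - y + v) (int p))
        \<le> (\<Sum>v\<in>{0..<int p}. 1)"
    proof (rule sum_mono)
      show "Legendre v (int p) * Legendre (x - y + v) (int p) \<le> 1" for v
        using Legendre_values[of v "int p"] Legendre_values[of "x - y + v" "int p"] by auto
    qed
    then show ?thesis using True by simp
  next
    case False
    then show ?thesis by (simp add: Legendre_correlation)
  qed
  finally show ?thesis .
qed

text \<open>Cauchy-Schwarz over \<open>W\<close> and expansion of the square reduce the estimate to
  correlations of translates, of which only the diagonal ones contribute.\<close>

lemma Legendre_sum_square_le:
  assumes U: "U \<subseteq> {0..<int p}" and W: "W \<subseteq> {0..<int p}"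
  shows "(\<Sum>w\<in>W. \<Sum>u\<in>U. real_of_int (Legendre (w - u) (int p)))\<^sup>2 \<le> real p * card U * card W"
proof -
  let ?F = "{0..<int p}"
  define S where "S w = (\<Sum>u\<in>U. real_of_int (Legendre (w - u) (int p)))" for w
  have fin: "finite U" "finite W" using assms finite_subset by blast+
  have "(\<Sum>w\<in>W. S w)\<^sup>2 \<le> (\<Sum>w\<in>W. (S w)\<^sup>2) * card W"
    by (rule sum_squared_le_sum_of_squares)
  \<comment> \<open>Extending the sum from \<open>W\<close> to all residues only adds squares and
    makes the inner sums complete.\<close>
  also have "\<dots> \<le> (\<Sum>w\<in>?F. (S w)\<^sup>2) * card W"
    using W by (auto intro!: mult_right_mono sum_mono2)
  also have "(\<Sum>w\<in>?F. (S w)\<^sup>2) \<le> real p * card U"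
  proof -
    have "(\<Sum>w\<in>?F. (S w)\<^sup>2) = real_of_int (\<Sum>w\<in>?F. \<Sum>u\<in>U. \<Sum>v\<in>U.
        Legendre (w - u) (int p) * Legendre (w - v) (int p))"
      unfolding S_def power2_eq_square sum_product by simp
    also have "(\<Sum>w\<in>?F. \<Sum>u\<in>U. \<Sum>v\<in>U. Legendre (w - u) (int p) * Legendre (w - v) (int p))
        = (\<Sum>u\<in>U. \<Sum>w\<in>?F. \<Sum>v\<in>U. Legendre (w - u) (int p) * Legendre (w - v) (int p))"
      by (rule sum.swap)
    also have "\<dots>
        = (\<Sum>u\<in>U. \<Sum>v\<in>U. \<Sum>w\<in>?F. Legendre (w - u) (int p) * Legendre (w - v) (int p))"
      by (intro sum.cong refl sum.swap)
    also have "\<dots> \<le> (\<Sum>u\<in>U. \<Sum>v\<in>U. if u = v then int p else 0)"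
    proof (intro sum_mono)
      fix u v assume "u \<in> U" "v \<in> U"
      with U have "u mod int p = u" "v mod int p = v" by auto
      \<comment> \<open>Distinct elements of \<open>U\<close> are reduced residues, hence
        incongruent modulo \<open>p\<close>.\<close>
      then have "int p dvd u - v \<longleftrightarrow> u = v" using mod_eq_dvd_iff[of u "int p" v] by simp
      then show "(\<Sum>w\<in>?F. Legendre (w - u) (int p) * Legendre (w - v) (int p))
          \<le> (if u = v then int p else 0)"
        using sum_Legendre_differences[of u v] by simp
    qed
    also have "\<dots> = int p * card U" using fin by simp
    finally show ?thesis by simp
  qed
  finally show ?thesis unfolding S_def by (simp add: mult_right_mono)
qed

end

section \<open>Paley graphs and their localizations\<close>

lemma dominates_induce_subgraph_iff:
  "u \<rightarrow>\<^bsub>G \<restriction> W\<^esub> v \<longleftrightarrow> u \<in> W \<and> v \<in> W \<and> u \<rightarrow>\<^bsub>G\<^esub> v"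
  by (auto simp: arcs_ends_conv)

lemma verts_paley_graph [simp]: "verts (paley_graph p) = {0..<int p}"
  by (simp add: paley_graph_def)

lemma paley_graph_dominates_iff:
  "u \<rightarrow>\<^bsub>paley_graph p\<^esub> v \<longleftrightarrow>
     u \<in> {0..<int p} \<and> v \<in> {0..<int p} \<and> Legendre (u - v) (int p) = 1"
  by (auto simp: paley_graph_def Legendre_def)

lemma Legendre_residue_diff_eq_0_iff:
  assumes "u \<in> {0..<int p}" "v \<in> {0..<int p}"
  shows "Legendre (u - v) (int p) = 0 \<longleftrightarrow> u = v"
proof -
  have "u mod int p = u" "v mod int p = v" using assms by auto
  then show ?thesis using mod_eq_dvd_iff[of u "int p" v] by (simp add: Legendre_eq_0_iff)
qed

text \<open>Between residues the symbol of a difference is 0 only for equal vertices and 1 only for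
  adjacent ones; excluding both leaves -1.\<close>

lemma verts_paley_localization:
  assumes "I \<subseteq> {0..<int p}"
  shows "verts (paley_localization p I)
    = {v \<in> {0..<int p}. \<forall>x\<in>I. Legendre (v - x) (int p) = - 1}"
proof -
  have "v \<notin> I \<and> (\<forall>x\<in>I. \<not> v \<rightarrow>\<^bsub>paley_graph p\<^esub> x) \<longleftrightarrow> (\<forall>x\<in>I. Legendre (v - x) (int p) = - 1)"
    if "v \<in> {0..<int p}" for v
    using that assms Legendre_residue_diff_eq_0_iff[of v p] Legendre_values[of "v - x" "int p" for x]
    unfolding paley_graph_dominates_iff
    by (smt (verit, best) subsetD)
  then show ?thesis by (auto simp: paley_localization_def)
qed

lemma is_independent_paley_iff:
  "is_independent (paley_graph p) S \<longleftrightarrow>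
     S \<subseteq> {0..<int p} \<and> (\<forall>u\<in>S. \<forall>v\<in>S. Legendre (u - v) (int p) \<noteq> 1)"
  unfolding is_independent_def paley_graph_dominates_iff verts_paley_graph by blast

lemma Legendre_diff_independent:
  assumes S: "is_independent (paley_graph p) S" and uv: "u \<in> S" "v \<in> S" "u \<noteq> v"
  shows "Legendre (u - v) (int p) = - 1"
proof -
  have "u \<in> {0..<int p}" "v \<in> {0..<int p}" "Legendre (u - v) (int p) \<noteq> 1"
    using S uv(1,2) unfolding is_independent_paley_iff by blast+
  then show ?thesis
    using uv(3) Legendre_residue_diff_eq_0_iff[of u p v] Legendre_values[of "u - v" "int p"] by blast
qed

lemma is_clique_paley_iff:
  "is_clique (paley_graph p) S \<longleftrightarrow>
     S \<subseteq> {0..<int p} \<and> (\<forall>u\<in>S. \<forall>v\<in>S. u \<noteq> v \<longrightarrow> Legendre (u - v) (int p) = 1)"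
  unfolding is_clique_def paley_graph_dominates_iff verts_paley_graph by blast

lemma paley_primes_gt_2:
  assumes "p \<in> paley_primes"
  shows "prime p" "2 < p"
proof -
  show "prime p" using assms by (simp add: paley_primes_def)
  then have "p \<ge> 2" by (rule prime_ge_2_nat)
  moreover have "p \<noteq> 2" using assms by (auto simp: paley_primes_def cong_def)
  ultimately show "2 < p" by simp
qed

text \<open>Since \<open>p\<close> is 1 modulo 4, the exponent in Euler's criterion is even, so -1
  is a quadratic residue and reversing a difference keeps its symbol.\<close>

lemma paley_graph_sym:
  assumes "p \<in> paley_primes" and "u \<rightarrow>\<^bsub>paley_graph p\<^esub> v"
  shows "v \<rightarrow>\<^bsub>paley_graph p\<^esub> u"
proof -
  note p = paley_primes_gt_2[OF assms(1)]
  from assms(1) have "p mod 4 = 1" by (simp add: paley_primes_def cong_def)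
  then have "even ((p - 1) div 2)" by presburger
  with euler_criterion[OF p, of "- 1"] have "[Legendre (- 1) (int p) = 1] (mod int p)" by simp
  then have "int p dvd Legendre (- 1) (int p) - 1" by (simp add: cong_iff_dvd_diff)
  then have "Legendre (- 1) (int p) = 1"
    using Legendre_values[of "- 1" "int p"] p(2)
      zdvd_imp_le[of "int p" 1] zdvd_imp_le[of "int p" 2] by auto
  with Legendre_mult[OF p, of "- 1" "u - v"] assms(2) show ?thesis
    by (simp add: paley_graph_dominates_iff)
qed

text \<open>Multiplication by a quadratic nonresidue exchanges cliques and independent sets.\<close>

lemma paley_clique_number_eq_independence_number:
  assumes "p \<in> paley_primes"
  shows "clique_number (paley_graph p) = independence_number (paley_graph p)"
proof -
  note p = paley_primes_gt_2[OF assms]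
  obtain g where g: "Legendre g (int p) = - 1" using quadratic_nonresidue_exists[OF p] by blast
  then have "\<not> int p dvd g" using Legendre_eq_0_iff[of g "int p"] by auto
  define h where "h x = g * x mod int p" for x
  have bij: "bij_betw h {0..<int p} {0..<int p}"
    using bij_betw_affine_mod[OF p \<open>\<not> int p dvd g\<close>, of 0] by (simp add: h_def[abs_def])
  have h: "Legendre (h u - h v) (int p) = - Legendre (u - v) (int p)" for u v
  proof -
    have "Legendre (h u - h v) (int p) = Legendre (g * (u - v)) (int p)"
      unfolding h_def
      by (rule Legendre_cong) (simp add: cong_def mod_diff_eq right_diff_distrib)
    then show ?thesis by (simp add: Legendre_mult[OF p] g)
  qed
  have hF: "h ` S \<subseteq> {0..<int p}" and hcard: "card (h ` S) = card S" if "S \<subseteq> {0..<int p}" for S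
    using that bij by (auto simp: bij_betw_def intro!: card_image intro: inj_on_subset)
  have 1: "is_independent (paley_graph p) (h ` S)" if "is_clique (paley_graph p) S" for S
    unfolding is_independent_paley_iff
  proof (intro conjI ballI)
    show "h ` S \<subseteq> {0..<int p}" using that hF by (simp add: is_clique_paley_iff)
    fix x y assume "x \<in> h ` S" "y \<in> h ` S"
    then obtain u v where uv: "u \<in> S" "v \<in> S" "x = h u" "y = h v" by blast
    then show "Legendre (x - y) (int p) \<noteq> 1"
      using that h[of u v] Legendre_eq_0_iff[of 0 "int p"]
      by (cases "u = v") (auto simp: is_clique_paley_iff)
  qed
  have 2: "is_clique (paley_graph p) (h ` S)" if S: "is_independent (paley_graph p) S" for S
    unfolding is_clique_paley_iff
  proof (intro conjI ballI impI)
    show "h ` S \<subseteq> {0..<int p}" using S hF by (simp add: is_independent_paley_iff)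
    fix x y assume "x \<in> h ` S" "y \<in> h ` S" "x \<noteq> y"
    then obtain u v where uv: "u \<in> S" "v \<in> S" "x = h u" "y = h v" "u \<noteq> v" by blast
    then have "Legendre (u - v) (int p) = - 1" using Legendre_diff_independent[OF S] by blast
    then show "Legendre (x - y) (int p) = 1" using uv h by simp
  qed
  have "card ` {S. is_clique (paley_graph p) S} = card ` {S. is_independent (paley_graph p) S}"
  proof (intro equalityI subsetI)
    fix k assume "k \<in> card ` {S. is_clique (paley_graph p) S}"
    then obtain S where "is_clique (paley_graph p) S" "k = card S" by blast
    then show "k \<in> card ` {S. is_independent (paley_graph p) S}"
      using 1[of S] hcard[of S] by (intro image_eqI[of _ _ "h ` S"]) (auto simp: is_clique_paley_iff)
  next
    fix k assume "k \<in> card ` {S. is_independent (paley_graph p) S}"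
    then obtain S where "is_independent (paley_graph p) S" "k = card S" by blast
    then show "k \<in> card ` {S. is_clique (paley_graph p) S}"
      using 2[of S] hcard[of S]
      by (intro image_eqI[of _ _ "h ` S"]) (auto simp: is_independent_paley_iff)
  qed
  then show ?thesis by (simp add: clique_number_def independence_number_def)
qed

text \<open>Greedy choice: the bound on bilinear character sums yields at each step an element of \<open>S\<close>
  that is non-adjacent to at least an eighth of the vertices still available.\<close>

lemma large_common_non_neighbourhood:
  assumes p: "prime p" "2 < p"
    and S: "S \<subseteq> {0..<int p}" "k + 4 * 8 ^ k \<le> card S"
    and large: "4 * 8 ^ k \<le> p"
  shows "\<exists>I\<subseteq>S. card I = k \<and>
    p \<le> 8 ^ k * card {v \<in> {0..<int p}. \<forall>x\<in>I. Legendre (v - x) (int p) = - 1}"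
  using S(2) large
proof (induction k)
  case 0
  have "{v \<in> {0..<int p}. \<forall>x\<in>{}. Legendre (v - x) (int p) = - 1} = {0..<int p}" by auto
  then show ?case by (intro exI[of _ "{}"]) (simp del: atLeastLessThan_iff)
next
  case (Suc k)
  define N where "N I = {v \<in> {0..<int p}. \<forall>x\<in>I. Legendre (v - x) (int p) = - 1}" for I
  have finS: "finite S" using S(1) finite_subset by blast
  obtain I where I: "I \<subseteq> S" "card I = k" and NI: "p \<le> 8 ^ k * card (N I)"
    using Suc unfolding N_def by auto
  define n where "n = card (N I)"
  define s where "s = card (S - I)"
  have finN: "finite (N I)" unfolding N_def by (rule finite_subset[of _ "{0..<int p}"]) auto
  have s: "4 * 8 ^ k \<le> s"
    using Suc.prems(1) I finS finite_subset[OF I(1) finS] by (simp add: s_def card_Diff_subset)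
  have "4 * 8 ^ k \<le> (4 * 8 ^ Suc k :: nat)" by simp
  also note Suc.prems(2)
  also note NI[folded n_def]
  finally have n: "4 \<le> n" by (simp add: mult.commute)
  have "4 * p \<le> 4 * (8 ^ k * n)" using NI by (simp add: n_def)
  also have "\<dots> \<le> s * n" using mult_right_mono[OF s, of n] by simp
  \<comment> \<open>This makes the bilinear bound sqrt(p s n) at most s n / 2, the contradiction
    sought in the averaging step.\<close>
  finally have ns: "4 * real p \<le> real s * real n" by (metis of_nat_mult of_nat_le_iff of_nat_numeral)
  \<comment> \<open>Averaging: if all these sums exceeded n / 2, their total would exceed s n /
    2.\<close>
  have "\<exists>x\<in>S - I. (\<Sum>v\<in>N I. real_of_int (Legendre (v - x) (int p))) \<le> n / 2"
  proof (rule ccontr)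
    assume "\<not> ?thesis"
    then have neg: "n / 2 < (\<Sum>v\<in>N I. real_of_int (Legendre (v - x) (int p)))" if "x \<in> S - I" for x
      using that by force
    have "0 < s" using s by (metis gr0I le_zero_eq mult_eq_0_iff power_eq_0_iff zero_neq_numeral)
    then have "S - I \<noteq> {}" unfolding s_def by (metis card.empty less_irrefl)
    define X where "X = (\<Sum>x\<in>S - I. \<Sum>v\<in>N I. real_of_int (Legendre (v - x) (int p)))"
    have "s * (n / 2) = (\<Sum>x\<in>S - I. n / 2)" by (simp add: s_def)
    also have "\<dots> < X" unfolding X_def using neg finS \<open>S - I \<noteq> {}\<close>
      by (intro sum_strict_mono) auto
    finally have "s * (n / 2) < X" .
    then have "(s * (n / 2))\<^sup>2 < X\<^sup>2" by (intro power_strict_mono) auto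
    also have "X = (\<Sum>v\<in>N I. \<Sum>x\<in>S - I. real_of_int (Legendre (v - x) (int p)))"
      unfolding X_def by (rule sum.swap)
    also have "\<dots>\<^sup>2 \<le> real p * s * n"
      unfolding s_def n_def by (rule Legendre_sum_square_le[OF p]) (use S(1) in \<open>auto simp: N_def\<close>)
    also have "\<dots> = (real s * real n) * real p" by simp
    also have "\<dots> \<le> (real s * real n) * (real s * real n / 4)" using ns by (intro mult_left_mono) auto
    also have "\<dots> = (s * (n / 2))\<^sup>2" by (simp add: power2_eq_square)
    finally show False by simp
  qed
  then obtain x where x: "x \<in> S" "x \<notin> I"
    and sum_le: "(\<Sum>v\<in>N I. real_of_int (Legendre (v - x) (int p))) \<le> n / 2" by blast
  have N_insert: "N (insert x I) = {v \<in> N I. Legendre (v - x) (int p) = - 1}"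
    unfolding N_def by auto
  \<comment> \<open>The weight 1 - chi is 2 at a non-neighbour of \<open>x\<close>, 0 at a neighbour
    and 1 at \<open>x\<close> itself, so its sum counts non-neighbours twice, up to one extra
    unit.\<close>
  have "n - n / 2 \<le> (\<Sum>v\<in>N I. 1 - real_of_int (Legendre (v - x) (int p)))"
    using sum_le by (simp add: sum_subtractf n_def)
  also have "\<dots> \<le> (\<Sum>v\<in>N I. (if Legendre (v - x) (int p) = - 1 then 2 else 0)
      + (if v = x then 1 else 0))"
  proof (rule sum_mono)
    fix v assume "v \<in> N I"
    then have "Legendre (v - x) (int p) = 0 \<longleftrightarrow> v = x"
      using Legendre_residue_diff_eq_0_iff[of v p x] x S(1) by (auto simp: N_def)
    then show "1 - real_of_int (Legendre (v - x) (int p))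
      \<le> (if Legendre (v - x) (int p) = - 1 then 2 else 0) + (if v = x then 1 else 0)"
      using Legendre_values[of "v - x" "int p"] by auto
  qed
  also have "\<dots> \<le> 2 * card (N (insert x I)) + 1"
    using finN by (simp add: sum.distrib N_insert sum.If_cases Int_def)
  \<comment> \<open>If m vertices remain, then n / 2 \<le> 2 m + 1; the bound n \<ge> 4 absorbs the
    1 at the cost of replacing the factor 4 by 8.\<close>
  finally have "real n \<le> 8 * card (N (insert x I))" using n by simp
  then have "n \<le> 8 * card (N (insert x I))" by linarith
  then have "8 ^ k * n \<le> 8 ^ k * (8 * card (N (insert x I)))" by (rule mult_le_mono2)
  from order_trans[OF NI[folded n_def] this]
  have "p \<le> 8 ^ Suc k * card (N (insert x I))" by (simp only: power_Suc mult_ac)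
  moreover have "card (insert x I) = Suc k"
    using x I finite_subset[OF I(1) finS] by simp
  ultimately show ?case using x(1) I(1) unfolding N_def by (intro exI[of _ "insert x I"]) auto
qed

text \<open>Hoffman's argument: Cauchy--Schwarz for the positive semidefinite form \<open>A + \<Lambda>\<close>, applied to
  the indicators of \<open>S - I\<close> and of the whole vertex set of the localization.\<close>

lemma paley_localization_ratio_bound:
  assumes p: "p \<in> paley_primes"
    and S: "is_independent (paley_graph p) S" and I: "I \<subseteq> S"
    and \<Lambda>: "1 / 2 \<le> \<Lambda>" "- lambda_min (adjacency_matrix (paley_localization p I)) \<le> \<Lambda>"
    and n: "n = real (card (verts (paley_localization p I)))"
    and t: "t = real (card (S - I))"
    and tn: "sqrt (p * t * n) \<le> t * n"
  shows "(t * n - sqrt (p * t * n))\<^sup>2 \<le> 2 * (n\<^sup>2 + sqrt p * n + 2 * \<Lambda> * n) * \<Lambda> * t"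
proof -
  let ?G = "paley_localization p I"
  define L where "L = verts ?G"
  define T where "T = S - I"
  define \<chi> where "\<chi> u v = real_of_int (Legendre (u - v) (int p))" for u v
  define A where "A u v = (if u \<rightarrow>\<^bsub>?G\<^esub> v then 1 else 0 :: real)" for u v
  define M where "M u v = A u v + (if u = v then \<Lambda> else 0)" for u v
  note pp = paley_primes_gt_2[OF p]
  have SF: "S \<subseteq> {0..<int p}" and ind: "\<And>u v. u \<in> S \<Longrightarrow> v \<in> S \<Longrightarrow> Legendre (u - v) (int p) \<noteq> 1"
    using S by (auto simp: is_independent_paley_iff)
  have L: "L = {v \<in> {0..<int p}. \<forall>x\<in>I. Legendre (v - x) (int p) = - 1}"
    unfolding L_def using I SF by (intro verts_paley_localization) auto
  have LF: "L \<subseteq> {0..<int p}" unfolding L by auto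
  then have finL: "finite L" by (rule finite_subset) simp
  have TL: "T \<subseteq> L"
  proof
    fix v assume v: "v \<in> T"
    have "Legendre (v - x) (int p) = - 1" if "x \<in> I" for x
      by (rule Legendre_diff_independent[OF S]) (use that v I in \<open>auto simp: T_def\<close>)
    then show "v \<in> L" using v SF by (auto simp: L T_def)
  qed
  have arc: "u \<rightarrow>\<^bsub>?G\<^esub> v \<longleftrightarrow> u \<in> L \<and> v \<in> L \<and> u \<rightarrow>\<^bsub>paley_graph p\<^esub> v" for u v
    unfolding L_def paley_localization_def dominates_induce_subgraph_iff by simp
  have arc_sym: "v \<rightarrow>\<^bsub>?G\<^esub> u" if "u \<rightarrow>\<^bsub>?G\<^esub> v" for u v
    using that paley_graph_sym[OF p] unfolding arc by blast
  \<comment> \<open>The adjacency indicator is (1 + chi) / 2 off the diagonal; the correction term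
    cancels the 1 on it.\<close>
  have A_eq: "A u v = (1 + \<chi> u v - (if u = v then 1 else 0)) / 2" if "u \<in> L" "v \<in> L" for u v
    using that LF Legendre_residue_diff_eq_0_iff[of u p v] Legendre_values[of "u - v" "int p"]
    by (auto simp: A_def arc \<chi>_def paley_graph_dominates_iff)
  have A_sum: "(\<Sum>u\<in>U. \<Sum>v\<in>L. A u v)
      = (card U * n + (\<Sum>u\<in>U. \<Sum>v\<in>L. \<chi> u v) - card U) / 2" if "U \<subseteq> L" for U
  proof -
    have "(\<Sum>u\<in>U. \<Sum>v\<in>L. A u v)
        = (\<Sum>u\<in>U. \<Sum>v\<in>L. (1 + \<chi> u v - (if u = v then 1 else 0)) / 2)"
      using that A_eq by (intro sum.cong) auto
    also have "\<dots> = (\<Sum>u\<in>U. (n + (\<Sum>v\<in>L. \<chi> u v) - 1) / 2)"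
    proof (rule sum.cong)
      fix u assume "u \<in> U"
      then have "u \<in> L" using that by blast
      then show "(\<Sum>v\<in>L. (1 + \<chi> u v - (if u = v then 1 else 0)) / 2)
          = (n + (\<Sum>v\<in>L. \<chi> u v) - 1) / 2"
        using finL
        by (simp add: sum_divide_distrib[symmetric] sum_subtractf sum.distrib n L_def[symmetric])
    qed simp
    also have "\<dots> = (card U * n + (\<Sum>u\<in>U. \<Sum>v\<in>L. \<chi> u v) - card U) / 2"
      by (simp add: sum_divide_distrib[symmetric] sum_subtractf sum.distrib)
    finally show ?thesis .
  qed
  have \<chi>_sum: "\<bar>\<Sum>u\<in>U. \<Sum>v\<in>L. \<chi> u v\<bar> \<le> sqrt (p * card U * n)" if "U \<subseteq> L" for U
  proof -
    have "(\<Sum>u\<in>U. \<Sum>v\<in>L. \<chi> u v)\<^sup>2 \<le> real p * card L * card U"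
      unfolding \<chi>_def using that LF by (intro Legendre_sum_square_le[OF pp]) auto
    then show ?thesis
      using real_sqrt_le_mono by (fastforce simp: n L_def[symmetric] mult_ac)
  qed
  have M_diag: "(\<Sum>u\<in>U. \<Sum>v\<in>W. if u = v then \<Lambda> * f u * g v else 0) = \<Lambda> * (\<Sum>u\<in>U. f u * g u)"
    if "U \<subseteq> W" "finite W" for U W and f g :: "int \<Rightarrow> real"
  proof -
    have "(\<Sum>u\<in>U. \<Sum>v\<in>W. if u = v then \<Lambda> * f u * g v else 0) = (\<Sum>u\<in>U. \<Lambda> * f u * g u)"
      using that by (intro sum.cong) auto
    then show ?thesis by (simp add: sum_distrib_left mult.assoc)
  qed
  have M_form: "(\<Sum>u\<in>L. \<Sum>v\<in>L. M u v * f u * g v)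
      = (\<Sum>u\<in>L. \<Sum>v\<in>L. A u v * f u * g v) + \<Lambda> * (\<Sum>u\<in>L. f u * g u)" for f g
  proof -
    have "(\<Sum>u\<in>L. \<Sum>v\<in>L. M u v * f u * g v) = (\<Sum>u\<in>L. \<Sum>v\<in>L. A u v * f u * g v)
        + (\<Sum>u\<in>L. \<Sum>v\<in>L. if u = v then \<Lambda> * f u * g v else 0)"
      unfolding M_def sum.distrib[symmetric] by (intro sum.cong) (auto simp: algebra_simps)
    then show ?thesis using M_diag[of L L f g] finL by simp
  qed
  define f where "f u = (if u \<in> T then 1 else 0 :: real)" for u
  have T_sum: "(\<Sum>u\<in>L. f u * g u) = (\<Sum>u\<in>T. g u)" for g
  proof -
    have "(\<Sum>u\<in>L. f u * g u) = (\<Sum>u\<in>L. if u \<in> T then g u else 0)"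
      unfolding f_def by (intro sum.cong) auto
    also have "\<dots> = (\<Sum>u\<in>L \<inter> T. g u)" using finL by (simp add: sum.inter_restrict)
    finally show ?thesis using TL by (simp add: Int_absorb1)
  qed
  have CS: "(\<Sum>u\<in>L. \<Sum>v\<in>L. M u v * f u * 1)\<^sup>2
      \<le> (\<Sum>u\<in>L. \<Sum>v\<in>L. M u v * f u * f v) * (\<Sum>u\<in>L. \<Sum>v\<in>L. M u v * 1 * 1)"
  proof (rule psd_form_Cauchy_Schwarz[where g = "\<lambda>_. 1"])
    show "M u v = M v u" for u v using arc_sym by (auto simp: M_def A_def)
    fix f :: "int \<Rightarrow> real"
    have "lambda_min (adjacency_matrix ?G) * (\<Sum>u\<in>L. (f u)\<^sup>2) \<le> (\<Sum>u\<in>L. \<Sum>v\<in>L. A u v * f u * f v)"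
      unfolding L_def A_def
      by (rule adjacency_matrix_lambda_min_le_form) (use finL arc_sym in \<open>auto simp: L_def\<close>)
    moreover have "- \<Lambda> * (\<Sum>u\<in>L. (f u)\<^sup>2) \<le> lambda_min (adjacency_matrix ?G) * (\<Sum>u\<in>L. (f u)\<^sup>2)"
      using \<Lambda>(2) by (intro mult_right_mono sum_nonneg) auto
    ultimately show "0 \<le> (\<Sum>u\<in>L. \<Sum>v\<in>L. M u v * f u * f v)"
      unfolding M_form by (simp add: power2_eq_square)
  qed
  have lhs: "(\<Sum>u\<in>L. \<Sum>v\<in>L. M u v * f u * 1) \<ge> (t * n - sqrt (p * t * n)) / 2"
  proof -
    have "(\<Sum>u\<in>L. \<Sum>v\<in>L. A u v * f u * 1) = (\<Sum>u\<in>L. f u * (\<Sum>v\<in>L. A u v))"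
      by (simp add: sum_distrib_left mult.commute)
    also have "\<dots> = (\<Sum>u\<in>T. \<Sum>v\<in>L. A u v)" by (rule T_sum)
    also have "\<dots> \<ge> (t * n - sqrt (p * t * n) - t) / 2"
      using A_sum[OF TL] \<chi>_sum[OF TL] by (simp add: t T_def[symmetric])
    finally have "(\<Sum>u\<in>L. \<Sum>v\<in>L. A u v * f u * 1) \<ge> (t * n - sqrt (p * t * n) - t) / 2" .
    \<comment> \<open>Here \<Lambda> \<ge> 1/2 compensates the loss t / 2 caused by the zero
      diagonal of the adjacency matrix.\<close>
    moreover have "\<Lambda> * (\<Sum>u\<in>L. f u * 1) \<ge> t / 2"
      unfolding T_sum using mult_right_mono[OF \<Lambda>(1), of t] by (simp add: t T_def[symmetric])
    ultimately have "(t * n - sqrt (p * t * n) - t) / 2 + t / 2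
        \<le> (\<Sum>u\<in>L. \<Sum>v\<in>L. A u v * f u * 1) + \<Lambda> * (\<Sum>u\<in>L. f u * 1)"
      by (rule add_mono)
    then show ?thesis unfolding M_form by (simp add: diff_divide_distrib)
  qed
  \<comment> \<open>Independence of \<open>T\<close> kills the adjacency part, so only the shift by
    \<Lambda> remains.\<close>
  have TT: "(\<Sum>u\<in>L. \<Sum>v\<in>L. M u v * f u * f v) = \<Lambda> * t"
  proof -
    have "A u v * f u * f v = 0" for u v
      using ind by (auto simp: A_def f_def arc paley_graph_dominates_iff T_def)
    then have "(\<Sum>u\<in>L. \<Sum>v\<in>L. A u v * f u * f v) = 0" by simp
    moreover have "(\<Sum>u\<in>L. f u * f u) = t"
      unfolding T_sum by (simp add: f_def t T_def[symmetric])
    ultimately show ?thesis unfolding M_form by simp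
  qed
  have n0: "n \<ge> 0" by (simp add: n)
  have LL: "(\<Sum>u\<in>L. \<Sum>v\<in>L. M u v * 1 * 1) \<le> (n\<^sup>2 + sqrt p * n) / 2 + \<Lambda> * n"
  proof -
    have "(\<Sum>u\<in>L. \<Sum>v\<in>L. \<chi> u v) \<le> sqrt p * n"
      using \<chi>_sum[of L] n0
      by (simp add: n[folded L_def, symmetric] real_sqrt_mult mult.assoc)
    then have "(\<Sum>u\<in>L. \<Sum>v\<in>L. A u v) \<le> (n\<^sup>2 + sqrt p * n) / 2"
      using A_sum[of L] n0 by (simp add: n[folded L_def, symmetric] power2_eq_square)
    moreover have "(\<Sum>u\<in>L. 1 * 1) = n" by (simp add: n L_def)
    ultimately show ?thesis using M_form[of "\<lambda>_. 1" "\<lambda>_. 1"] by simp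
  qed
  \<comment> \<open>Assumption \<open>tn\<close> makes the lower bound nonnegative, so that it may
    be squared.\<close>
  have "((t * n - sqrt (p * t * n)) / 2)\<^sup>2 \<le> (\<Sum>u\<in>L. \<Sum>v\<in>L. M u v * f u * 1)\<^sup>2"
    using lhs tn by (intro power_mono) auto
  also note CS
  also have "(\<Sum>u\<in>L. \<Sum>v\<in>L. M u v * f u * f v) * (\<Sum>u\<in>L. \<Sum>v\<in>L. M u v * 1 * 1)
      \<le> (\<Lambda> * t) * ((n\<^sup>2 + sqrt p * n) / 2 + \<Lambda> * n)"
    unfolding TT using LL \<Lambda>(1) by (intro mult_left_mono) (auto simp: t)
  finally have "(t * n - sqrt (p * t * n))\<^sup>2 \<le> 4 * ((\<Lambda> * t) * ((n\<^sup>2 + sqrt p * n) / 2 + \<Lambda> * n))"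
    by (simp add: power_divide)
  also have "\<dots> = 2 * (n\<^sup>2 + sqrt p * n + 2 * \<Lambda> * n) * \<Lambda> * t" by (simp add: algebra_simps)
  finally show ?thesis .
qed

section \<open>Asymptotics\<close>

lemma eventually_paley_at_top:
  assumes "eventually P at_top"
  shows "eventually P paley_at_top"
  using assms unfolding paley_at_top_def eventually_inf_principal by (auto elim: eventually_mono)

text \<open>Both error terms vanish as \<open>p\<close> grows, and the inequality tends to
  \<open>c < d\<close>. It supplies the last two premises of the numerical comparison below.\<close>

lemma ratio_bound_eventually_fails:
  fixes c d K K' :: real
  assumes "c < d"
  shows "eventually (\<lambda>p::nat. sqrt (K / sqrt p) \<le> 1 \<and>
    c * (1 + K' / sqrt p) < d * (1 - sqrt (K / sqrt p))\<^sup>2) at_top"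
proof -
  have inv: "((\<lambda>p. K / sqrt (real p)) \<longlongrightarrow> 0) at_top" for K :: real
    by (intro real_tendsto_divide_at_top[OF tendsto_const]
      filterlim_compose[OF sqrt_at_top filterlim_real_sequentially])
  have root: "((\<lambda>p. sqrt (K / sqrt (real p))) \<longlongrightarrow> 0) at_top"
    using tendsto_real_sqrt[OF inv] by simp
  have "((\<lambda>p. d * (1 - sqrt (K / sqrt (real p)))\<^sup>2 - c * (1 + K' / sqrt (real p)))
      \<longlongrightarrow> d * (1 - 0)\<^sup>2 - c * (1 + 0)) at_top"
    by (intro tendsto_intros root inv)
  then have "eventually (\<lambda>p::nat. 0 < d * (1 - sqrt (K / sqrt p))\<^sup>2 - c * (1 + K' / sqrt p)) at_top"
    using assms by (intro order_tendstoD(1)[of _ "d - c"]) auto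
  moreover have "eventually (\<lambda>p::nat. sqrt (K / sqrt p) < 1) at_top"
    using order_tendstoD(2)[OF root, of 1] by simp
  ultimately show ?thesis by eventually_elim auto
qed

lemma eventually_le_mult_sqrt:
  fixes b c :: real
  assumes "c > 0"
  shows "eventually (\<lambda>p::nat. b \<le> c * sqrt p) at_top"
  using filterlim_tendsto_pos_mult_at_top[OF tendsto_const assms
      filterlim_compose[OF sqrt_at_top filterlim_real_sequentially]]
  by (auto simp: filterlim_at_top)

lemma ratio_bound_imp_less:
  fixes n t p \<Lambda> c d \<kappa> :: real
  assumes pos: "0 < p" "0 < \<kappa>" "0 < c" "0 < d"
    and n: "\<kappa> * p \<le> n" and t: "d * sqrt p \<le> t" and \<Lambda>: "2 * \<Lambda> = c * sqrt p"
    and small: "sqrt (1 / (\<kappa> * d) / sqrt p) \<le> 1"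
    and gap: "c * (1 + (1 + c) / \<kappa> / sqrt p) < d * (1 - sqrt (1 / (\<kappa> * d) / sqrt p))\<^sup>2"
  shows "sqrt (p * t * n) \<le> t * n"
    and "2 * (n\<^sup>2 + sqrt p * n + 2 * \<Lambda> * n) * \<Lambda> * t < (t * n - sqrt (p * t * n))\<^sup>2"
proof -
  define r where "r = sqrt p"
  have r: "r > 0" "r\<^sup>2 = p" using pos by (auto simp: r_def)
  have np: "n > 0" using n pos by (smt (verit) mult_pos_pos)
  have tp: "t > 0" using t pos r by (smt (verit) mult_pos_pos r_def)
  \<comment> \<open>A bound for the relative error sqrt(p t n) / (t n), obtained from the lower
    bounds on \<open>t\<close> and \<open>n\<close>.\<close>
  define \<delta> where "\<delta> = sqrt (1 / (\<kappa> * d) / sqrt p)"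
  have "\<kappa> * p * (d * r) \<le> n * t"
    using n t pos r np by (intro mult_mono) (auto simp: r_def)
  then have "p / (t * n) \<le> p / (\<kappa> * p * (d * r))"
    using pos r np tp by (intro divide_left_mono) (auto simp: mult.commute)
  also have "\<dots> = 1 / (\<kappa> * d) / r" using pos by simp
  finally have "sqrt (p / (t * n)) \<le> \<delta>" unfolding \<delta>_def r_def by simp
  moreover have split: "sqrt (p * t * n) = t * n * sqrt (p / (t * n))"
  proof -
    have "p * t * n = (t * n)\<^sup>2 * (p / (t * n))" using np tp by (simp add: power2_eq_square)
    then have "sqrt (p * t * n) = sqrt ((t * n)\<^sup>2) * sqrt (p / (t * n))"
      by (simp only: real_sqrt_mult)
    then show ?thesis using np tp by simp
  qed
  ultimately have le: "sqrt (p * t * n) \<le> t * n * \<delta>" using np tp by simp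
  also have "\<dots> \<le> t * n" using small np tp by (simp add: \<delta>_def)
  finally show "sqrt (p * t * n) \<le> t * n" .
  \<comment> \<open>The leading term is factored out, leaving a relative error of order r / n, hence
    of order 1 / r.\<close>
  have "2 * (n\<^sup>2 + sqrt p * n + 2 * \<Lambda> * n) * \<Lambda> * t = c * r * t * n\<^sup>2 * (1 + (1 + c) * r / n)"
  proof -
    have "2 * (n\<^sup>2 + sqrt p * n + 2 * \<Lambda> * n) * \<Lambda> * t = (n\<^sup>2 + r * n + (2 * \<Lambda>) * n) * (2 * \<Lambda>) * t"
      by (simp add: r_def)
    also have "\<dots> = (n\<^sup>2 + r * n + c * r * n) * (c * r) * t" unfolding \<Lambda> r_def by simp
    also have "\<dots> = c * r * t * n\<^sup>2 * (1 + (1 + c) * r / n)"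
      using np by (simp add: field_simps power2_eq_square)
    finally show ?thesis .
  qed
  also have "(1 + c) * r / n \<le> (1 + c) * r / (\<kappa> * p)"
    using n np pos r by (intro divide_left_mono) auto
  also have "(1 + c) * r / (\<kappa> * p) = (1 + c) / \<kappa> / r"
    using r pos by (simp add: field_simps power2_eq_square flip: r(2))
  also have "c * r * t * n\<^sup>2 * (1 + (1 + c) / \<kappa> / r) = r * t * n\<^sup>2 * (c * (1 + (1 + c) / \<kappa> / r))"
    by simp
  also have "\<dots> < r * t * n\<^sup>2 * (d * (1 - \<delta>)\<^sup>2)"
    using gap r tp np by (intro mult_strict_left_mono) (auto simp: \<delta>_def r_def)
  also have "\<dots> = (d * r) * (t * n\<^sup>2 * (1 - \<delta>)\<^sup>2)" by simp
  also have "\<dots> \<le> t * (t * n\<^sup>2 * (1 - \<delta>)\<^sup>2)"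
    using t tp by (intro mult_right_mono) (auto simp: r_def)
  also have "\<dots> = (t * n - t * n * \<delta>)\<^sup>2" by (simp add: power2_eq_square algebra_simps)
  also have "\<dots> \<le> (t * n - sqrt (p * t * n))\<^sup>2"
    using le \<open>t * n * \<delta> \<le> t * n\<close> by (intro power_mono) auto
  finally show "2 * (n\<^sup>2 + sqrt p * n + 2 * \<Lambda> * n) * \<Lambda> * t < (t * n - sqrt (p * t * n))\<^sup>2"
    using pos r tp np by (simp add: mult_left_mono)
qed

section \<open>Extremal independent sets and the final estimate\<close>

lemma finite_independent_sets_paley: "finite (independent_sets a (paley_graph p))"
  by (rule finite_subset[of _ "Pow {0..<int p}"])
    (auto simp: independent_sets_def is_independent_def)

lemma independence_number_paley_attained:
  obtains S where "is_independent (paley_graph p) S" "card S = independence_number (paley_graph p)"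
proof -
  have "finite {S. is_independent (paley_graph p) S}"
    by (rule finite_subset[of _ "Pow {0..<int p}"]) (auto simp: is_independent_def)
  moreover have "is_independent (paley_graph p) {}" by (simp add: is_independent_def)
  ultimately have "Max (card ` {S. is_independent (paley_graph p) S})
      \<in> card ` {S. is_independent (paley_graph p) S}"
    by (intro Max_in) auto
  then show ?thesis using that unfolding independence_number_def by auto
qed

theorem theorem1p19:
  fixes a :: nat
  assumes "a \<ge> 1"
    and "((\<lambda>p. MIN I\<in>independent_sets a (paley_graph p).
              2 ^ (a + 1) / sqrt (real p) * lambda_min (adjacency_matrix (paley_localization p I)))
            \<longlongrightarrow> - 2 * sqrt (2 ^ a - 1)) paley_at_top"
    and "((\<lambda>p. MAX I\<in>independent_sets a (paley_graph p).
              2 ^ (a + 1) / sqrt (real p) * lambda_min (adjacency_matrix (paley_localization p I)))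
            \<longlongrightarrow> - 2 * sqrt (2 ^ a - 1)) paley_at_top"
  shows "\<exists>e :: nat \<Rightarrow> real. e \<in> o[paley_at_top](\<lambda>p. sqrt (real p)) \<and>
           (\<forall>p\<in>paley_primes.
              clique_number (paley_graph p) = independence_number (paley_graph p) \<and>
              real (independence_number (paley_graph p))
                \<le> sqrt (2 ^ a - 1) / 2 ^ (a - 1) * sqrt (real p) + e p)"
proof -
  define \<alpha> where "\<alpha> p = real (independence_number (paley_graph p))" for p
  define C :: real where "C = sqrt (2 ^ a - 1) / 2 ^ (a - 1)"
  \<comment> \<open>The positive part of the excess makes the inequality hold at every prime, so
    only its growth has to be estimated.\<close>
  define e where "e p = max 0 (\<alpha> p - C * sqrt p)" for p :: nat
  have pow: "(2::real) ^ a = 2 * 2 ^ (a - 1)" using assms(1) by (cases a) auto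
  have C: "C \<ge> 0" by (simp add: C_def)
  have bound: "eventually (\<lambda>p. \<alpha> p \<le> (C + \<epsilon>) * sqrt p) paley_at_top" if \<epsilon>: "\<epsilon> > 0" for \<epsilon>
  proof -
    \<comment> \<open>Two levels strictly between C and C + \<epsilon>: \<open>c\<close> governs the
      eigenvalue and \<open>d\<close> the size of \<open>S - I\<close>; the contradiction comes from
      \<open>c < d\<close>.\<close>
    define c where "c = C + \<epsilon> / 4"
    define d where "d = C + \<epsilon> / 2"
    define \<kappa> :: real where "\<kappa> = 1 / 8 ^ a"
    have cd: "0 < c" "c < d" "0 < d" "0 < \<kappa>" using C \<epsilon> by (auto simp: c_def d_def \<kappa>_def)
    define E where "E p I =
      2 ^ (a + 1) / sqrt (real p) * lambda_min (adjacency_matrix (paley_localization p I))" for p I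
    \<comment> \<open>The limit is -(2 ^ a) C, so it lies above this threshold. A bound on the
      minimum covers whichever set \<open>I\<close> the greedy choice returns.\<close>
    have MIN_gt: "eventually (\<lambda>p. - (2 ^ a * c) < (MIN I\<in>independent_sets a (paley_graph p). E p I))
        paley_at_top"
    proof (rule order_tendstoD(1)[OF assms(2)[folded E_def]])
      show "- (2 ^ a * c) < - 2 * sqrt (2 ^ a - 1)"
        using \<epsilon> unfolding c_def C_def pow by (simp add: field_simps)
    qed
    have C\<epsilon>: "0 < C + \<epsilon>" "0 < \<epsilon> / 2" using C \<epsilon> by auto
    have primes: "eventually (\<lambda>p. p \<in> paley_primes) paley_at_top"
      by (simp add: paley_at_top_def eventually_inf_principal)
    \<comment> \<open>Besides the strict gap, \<open>p\<close> must be large enough for the greedy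
      choice (\<open>S\<close> and \<open>p\<close> itself), for the removal of \<open>a\<close>
      vertices to cost at most half of \<epsilon> sqrt p, and for \<Lambda> \<ge> 1/2.\<close>
    show ?thesis
      using MIN_gt primes
        eventually_paley_at_top[OF ratio_bound_eventually_fails[OF cd(2),
            of "1 / (\<kappa> * d)" "(1 + c) / \<kappa>"]]
        eventually_paley_at_top[OF eventually_le_mult_sqrt[OF C\<epsilon>(1), of "real (a + 4 * 8 ^ a)"]]
        eventually_paley_at_top[OF eventually_le_mult_sqrt[OF C\<epsilon>(2), of "real a"]]
        eventually_paley_at_top[OF eventually_le_mult_sqrt[OF cd(1), of 1]]
        eventually_paley_at_top[OF eventually_ge_at_top[of "4 * 8 ^ a"]]
    proof eventually_elim
      case (elim p)
      note p = paley_primes_gt_2[OF elim(2)]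
      show ?case
      proof (rule ccontr)
        assume "\<not> ?case"
        then have big: "(C + \<epsilon>) * sqrt p < \<alpha> p" by simp
        obtain S where S: "is_independent (paley_graph p) S" "real (card S) = \<alpha> p"
          using independence_number_paley_attained unfolding \<alpha>_def by metis
        then have SF: "S \<subseteq> {0..<int p}" by (simp add: is_independent_paley_iff)
        have "real (a + 4 * 8 ^ a) \<le> real (card S)" using elim(4) big S(2) C \<epsilon> by linarith
        then have "a + 4 * 8 ^ a \<le> card S" by (simp only: of_nat_le_iff)
        from large_common_non_neighbourhood[OF p SF this elim(7)]
        obtain I where I: "I \<subseteq> S" "card I = a"
          and "p \<le> 8 ^ a * card {v \<in> {0..<int p}. \<forall>x\<in>I. Legendre (v - x) (int p) = - 1}" by blast
        then have NI: "p \<le> 8 ^ a * card (verts (paley_localization p I))"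
          using SF verts_paley_localization[of I p] by auto
        define n where "n = real (card (verts (paley_localization p I)))"
        define t where "t = real (card (S - I))"
        \<comment> \<open>The normalisation of \<open>E\<close> turns the threshold -(2 ^ a) c into
          exactly this bound on the negated eigenvalue.\<close>
        define \<Lambda> where "\<Lambda> = c * sqrt p / 2"
        have n: "\<kappa> * p \<le> n"
        proof -
          have "real p \<le> 8 ^ a * n"
            using NI unfolding n_def by (metis of_nat_le_iff of_nat_mult of_nat_numeral of_nat_power)
          then show ?thesis by (simp add: \<kappa>_def field_simps)
        qed
        have t: "d * sqrt p \<le> t"
        proof -
          have "finite S" using SF finite_subset by blast
          then have "t = \<alpha> p - a"
            using I S(2) card_mono[of S I] finite_subset[of I S]
            by (simp add: t_def card_Diff_subset of_nat_diff)
          then show ?thesis using big elim(5) by (simp add: d_def algebra_simps)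
        qed
        have pos: "0 < real p" using p(2) by simp
        note numeric = ratio_bound_imp_less[OF pos cd(4,1,3) n t, of \<Lambda>]
        have "I \<in> independent_sets a (paley_graph p)"
          using I S(1) by (auto simp: independent_sets_def is_independent_def)
        then have "(MIN I\<in>independent_sets a (paley_graph p). E p I) \<le> E p I"
          using finite_independent_sets_paley by (intro Min_le) auto
        with elim(1) have "- (2 ^ a * c) < E p I" by linarith
        moreover have "E p I
            = 2 ^ a * (2 * lambda_min (adjacency_matrix (paley_localization p I)) / sqrt p)"
          by (simp add: E_def)
        ultimately have "2 ^ a * (- c)
            < 2 ^ a * (2 * lambda_min (adjacency_matrix (paley_localization p I)) / sqrt p)"
          by simp
        then have "- c < 2 * lambda_min (adjacency_matrix (paley_localization p I)) / sqrt p"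
          by (rule mult_left_less_imp_less) simp
        then have "- lambda_min (adjacency_matrix (paley_localization p I)) \<le> \<Lambda>"
          using pos by (simp add: \<Lambda>_def field_simps)
        moreover have "1 / 2 \<le> \<Lambda>" using elim(6) by (simp add: \<Lambda>_def)
        moreover have "sqrt (p * t * n) \<le> t * n" using elim(3) by (intro numeric) (auto simp: \<Lambda>_def)
        ultimately have "(t * n - sqrt (p * t * n))\<^sup>2 \<le> 2 * (n\<^sup>2 + sqrt p * n + 2 * \<Lambda> * n) * \<Lambda> * t"
          by (intro paley_localization_ratio_bound[OF elim(2) S(1) I(1)]) (auto simp: n_def t_def)
        moreover have "2 * (n\<^sup>2 + sqrt p * n + 2 * \<Lambda> * n) * \<Lambda> * t < (t * n - sqrt (p * t * n))\<^sup>2"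
          using elim(3) by (intro numeric) (auto simp: \<Lambda>_def)
        ultimately show False by linarith
      qed
    qed
  qed
  have "e \<in> o[paley_at_top](\<lambda>p. sqrt (real p))"
  proof (rule landau_o.smallI)
    fix \<epsilon> :: real assume "\<epsilon> > 0"
    from bound[OF this] show "eventually (\<lambda>p. norm (e p) \<le> \<epsilon> * norm (sqrt (real p))) paley_at_top"
      by eventually_elim (use \<open>\<epsilon> > 0\<close> in \<open>auto simp: e_def algebra_simps\<close>)
  qed
  moreover have "\<alpha> p \<le> C * sqrt p + e p" for p by (simp add: e_def)
  ultimately show ?thesis
    using paley_clique_number_eq_independence_number unfolding \<alpha>_def C_def by blast
qed

end
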